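(* Let $\mathcal{H}$ be a separable Hilbert space, $\mathcal{Z}$ a Hilbert space, $\mathcal{B}$ a Banach space, $\flat:\mathcal{H}\times\mathcal{B}\to\mathcal{Z}$ a bounded bilinear mapping with dense range, and $K\in\mathcal{L}(\mathcal{Z})$. Let $\{x_i\}_{i\in\mathbb{N}}\subset\mathcal{B}$ be a $K$-$\flat$-frame for $\mathcal{Z}$, and let $Q\in\mathcal{L}(\mathcal{Z})$ be such that $\mathcal{R}(Q)\subseteq\mathcal{R}(K)$. Then $\{x_i\}_{i\in\mathbb{N}}$ is also a $Q$-$\flat$-frame for $\mathcal{Z}$.
   Context: All spaces are over $\mathbb{C}$; $\mathcal{L}(\mathcal{Z})$ is the set of bounded linear operators on $\mathcal{Z}$; $\mathcal{R}(\cdot)$ denotes range. Bounded bilinear means there is $M>0$ with $\|\flat(h,x)\|_{\mathcal{Z}}\le M\|h\|_{\mathcal{H}}\|x\|$ for all $h\in\mathcal{H}$, $x\in\mathcal{B}$. For $z\in\mathcal{Z}$, $x\in\mathcal{B}$, the $\flat$-dual product $\langle z/x\rangle\in\mathcal{H}$ is the unique vector with $\langle\flat(h,x),z\rangle_{\mathcal{Z}}=\langle h,\langle z/x\rangle\rangle_{\mathcal{H}}$ for all $h\in\mathcal{H}$. For $K\in\mathcal{L}(\mathcal{Z})$, $\{x_i\}\subset\mathcal{B}$ is a $K$-$\flat$-frame for $\mathcal{Z}$ if there are constants $0<A\le B<\infty$ with $A\|K^*z\|_{\mathcal{Z}}^2\le\sum_{i=1}^\infty\|\langle z/x_i\rangle\|_{\mathcal{H}}^2\le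 B\|z\|_{\mathcal{Z}}^2$ for all $z\in\mathcal{Z}$. *)

theory Defs
  imports "HOL-Analysis.Analysis"
begin

text \<open>
  Complex normed spaces extend \<open>real_normed_vector\<close>, so that topology, convergence and
  completeness are the library's; the axiom \<open>scaleR_scaleC\<close> makes the real scalar
  multiplication the restriction of the complex one.
\<close>

class complex_normed_vector = real_normed_vector +
  fixes scaleC :: "complex \<Rightarrow> 'a \<Rightarrow> 'a" (infixr \<open>*\<^sub>C\<close> 75)
  assumes scaleC_add_right: "a *\<^sub>C (x + y) = a *\<^sub>C x + a *\<^sub>C y"
    and scaleC_add_left: "(a + b) *\<^sub>C x = a *\<^sub>C x + b *\<^sub>C x"
    and scaleC_scaleC: "a *\<^sub>C (b *\<^sub>C x) = (a * b) *\<^sub>C x"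
    and scaleC_one: "1 *\<^sub>C x = x"
    and scaleR_scaleC: "r *\<^sub>R x = complex_of_real r *\<^sub>C x"
    and norm_scaleC: "norm (a *\<^sub>C x) = cmod a * norm x"

lemma vector_space_scaleC:
  "vector_space (scaleC :: complex \<Rightarrow> 'a \<Rightarrow> 'a::complex_normed_vector)"
  by unfold_locales (simp_all add: scaleC_add_right scaleC_add_left scaleC_scaleC scaleC_one)

class cbanach = complex_normed_vector + complete_space

text \<open>
  The inner product is linear in its first argument. Positive definiteness is contained in
  \<open>cinner_self\<close>, since \<open>norm\<close> is a norm.
\<close>

class complex_inner = complex_normed_vector +
  fixes cinner :: "'a \<Rightarrow> 'a \<Rightarrow> complex"
  assumes cinner_commute: "cinner x y = cnj (cinner y x)"
    and cinner_add_left: "cinner (x + y) z = cinner x z + cinner y z"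
    and cinner_scaleC_left: "cinner (a *\<^sub>C x) y = a * cinner x y"
    and cinner_self: "cinner x x = complex_of_real ((norm x)\<^sup>2)"

class chilbert_space = complex_inner + complete_space

instantiation complex :: chilbert_space
begin

definition scaleC_complex :: "complex \<Rightarrow> complex \<Rightarrow> complex"
  where "scaleC_complex a x = a * x"

definition cinner_complex :: "complex \<Rightarrow> complex \<Rightarrow> complex"
  where "cinner_complex x y = x * cnj y"

instance
  by standard
    (simp_all add: scaleC_complex_def cinner_complex_def algebra_simps scaleR_conv_of_real
      norm_mult complex_norm_square del: of_real_power)

end

abbreviation clinear :: "('a::complex_normed_vector \<Rightarrow> 'b::complex_normed_vector) \<Rightarrow> bool"
  where "clinear \<equiv> Vector_Spaces.linear scaleC scaleC"

definition bounded_clinear ::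
    "('a::complex_normed_vector \<Rightarrow> 'b::complex_normed_vector) \<Rightarrow> bool"
  where "bounded_clinear T \<longleftrightarrow> clinear T \<and> (\<exists>M. \<forall>x. norm (T x) \<le> M * norm x)"

definition bounded_cbilinear ::
    "('h::complex_normed_vector \<Rightarrow> 'b::complex_normed_vector \<Rightarrow> 'z::complex_normed_vector) \<Rightarrow> bool"
  where "bounded_cbilinear \<beta> \<longleftrightarrow>
    (\<forall>x. clinear (\<lambda>h. \<beta> h x)) \<and> (\<forall>h. clinear (\<lambda>x. \<beta> h x)) \<and>
    (\<exists>M>0. \<forall>h x. norm (\<beta> h x) \<le> M * norm h * norm x)"

text \<open>
  The descriptions in \<open>cadjoint\<close> and \<open>flat_dual\<close> denote by the Riesz representation theorem
  whenever \<open>T\<close> is bounded linear, respectively \<open>\<beta>\<close> is bounded bilinear, on Hilbert spaces.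
\<close>

definition cadjoint :: "('a::complex_inner \<Rightarrow> 'b::complex_inner) \<Rightarrow> 'b \<Rightarrow> 'a"
  where "cadjoint T = (THE S. \<forall>x y. cinner (T x) y = cinner x (S y))"

definition flat_dual ::
    "('h::complex_inner \<Rightarrow> 'b \<Rightarrow> 'z::complex_inner) \<Rightarrow> 'z \<Rightarrow> 'b \<Rightarrow> 'h"
  where "flat_dual \<beta> z x = (THE u. \<forall>h. cinner (\<beta> h x) z = cinner h u)"

text \<open>
  Convergence of the series, implicit in the upper frame bound, has to be stated because
  \<open>suminf\<close> is an arbitrary real on divergent series.
\<close>

definition K_flat_frame ::
    "('h::complex_inner \<Rightarrow> 'b \<Rightarrow> 'z::complex_inner) \<Rightarrow> ('z \<Rightarrow> 'z) \<Rightarrow> (nat \<Rightarrow> 'b) \<Rightarrow> bool"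
  where "K_flat_frame \<beta> K x \<longleftrightarrow>
    (\<exists>A B :: real. 0 < A \<and> A \<le> B \<and>
      (\<forall>z. summable (\<lambda>i. (norm (flat_dual \<beta> z (x i)))\<^sup>2) \<and>
           A * (norm (cadjoint K z))\<^sup>2 \<le> (\<Sum>i. (norm (flat_dual \<beta> z (x i)))\<^sup>2) \<and>
           (\<Sum>i. (norm (flat_dual \<beta> z (x i)))\<^sup>2) \<le> B * (norm z)\<^sup>2))"

end

theory Submission
  imports Defs
begin

text \<open>The frame sum and its upper bound do not mention the operator, so only the lower bound
  has to pass from \<open>K\<close> to \<open>Q\<close>. Douglas' majorisation does this
  (\<open>range_inclusion_imp_cadjoint_bound\<close>): range inclusion forces
  \<open>norm (cadjoint Q z) \<le> c * norm (cadjoint K z)\<close> with \<open>c\<close> independent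
  of \<open>z\<close>, and \<open>A / c\<^sup>2\<close> becomes the new lower constant. The
  uniformity of \<open>c\<close> comes from Baire's theorem on the domain of \<open>Q\<close>. Since
  \<open>cadjoint\<close> is a definite description, its defining identity
  (\<open>cinner_cadjoint\<close>) needs existence and uniqueness, supplied by
  \<open>riesz_representation\<close> and \<open>cinner_ext\<close>.\<close>

section \<open>Inner product geometry\<close>

lemma cinner_add_right: "cinner x (y + z) = cinner x y + cinner x z"
  for x :: "'a::complex_inner"
  by (metis cinner_commute cinner_add_left complex_cnj_add)

lemma cinner_scaleC_right: "cinner x (a *\<^sub>C y) = cnj a * cinner x y"
  for x :: "'a::complex_inner"
  by (metis cinner_commute cinner_scaleC_left complex_cnj_mult)

lemma cinner_scaleR_left: "cinner (r *\<^sub>R x) y = complex_of_real r * cinner x y"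
  for x :: "'a::complex_inner"
  by (simp add: scaleR_scaleC cinner_scaleC_left)

lemma cinner_scaleR_right: "cinner x (r *\<^sub>R y) = complex_of_real r * cinner x y"
  for x :: "'a::complex_inner"
  by (simp add: scaleR_scaleC cinner_scaleC_right)

lemma cinner_minus_left: "cinner (- x) y = - cinner x y"
  for x :: "'a::complex_inner"
  using cinner_scaleR_left[of "-1" x y] by simp

lemma cinner_minus_right: "cinner x (- y) = - cinner x y"
  for x :: "'a::complex_inner"
  using cinner_scaleR_right[of x "-1" y] by simp

lemma cinner_diff_left: "cinner (x - y) z = cinner x z - cinner y z"
  for x :: "'a::complex_inner"
  using cinner_add_left[of x "- y" z] by (simp add: cinner_minus_left)

lemma cinner_diff_right: "cinner x (y - z) = cinner x y - cinner x z"
  for x :: "'a::complex_inner"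
  using cinner_add_right[of x y "- z"] by (simp add: cinner_minus_right)

lemma Re_cinner_commute: "Re (cinner x y) = Re (cinner y x)"
  for x :: "'a::complex_inner"
  by (metis cinner_commute cnj.simps(1))

lemma norm_add_sq: "(norm (x + y))\<^sup>2 = (norm x)\<^sup>2 + 2 * Re (cinner x y) + (norm y)\<^sup>2"
  for x :: "'a::complex_inner"
proof -
  have "complex_of_real ((norm (x + y))\<^sup>2)
      = cinner x x + cinner x y + (cinner y x + cinner y y)"
    by (simp only: cinner_self[symmetric] cinner_add_left cinner_add_right ac_simps)
  then have "Re (complex_of_real ((norm (x + y))\<^sup>2))
      = Re (cinner x x) + Re (cinner x y) + (Re (cinner y x) + Re (cinner y y))"
    by simp
  then show ?thesis
    using Re_cinner_commute[of y x] by (simp only: cinner_self Re_complex_of_real)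
qed

lemma norm_diff_sq: "(norm (x - y))\<^sup>2 = (norm x)\<^sup>2 - 2 * Re (cinner x y) + (norm y)\<^sup>2"
  for x :: "'a::complex_inner"
  using norm_add_sq[of x "- y"] by (simp add: cinner_minus_right)

text \<open>The triangle inequality is already an axiom of the norm, so the real part of
  Cauchy-Schwarz drops out of expanding its square.\<close>

lemma Re_cinner_le: "Re (cinner x y) \<le> norm x * norm y"
  for x :: "'a::complex_inner"
proof -
  have "(norm (x + y))\<^sup>2 \<le> (norm x + norm y)\<^sup>2"
    by (simp add: norm_triangle_ineq power_mono)
  then show ?thesis
    by (simp add: norm_add_sq power2_sum)
qed

lemma norm_cinner_le: "cmod (cinner x y) \<le> norm x * norm y"
  for x :: "'a::complex_inner"
proof (cases "cinner x y = 0")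
  case False
  \<comment> \<open>A unimodular factor turns the inner product into its modulus, which reduces the
    claim to real parts.\<close>
  define a where "a = cnj (sgn (cinner x y))"
  have a: "cmod a = 1"
    using False by (simp add: a_def norm_sgn)
  have "cinner (a *\<^sub>C x) y = complex_of_real (cmod (cinner x y))"
    using False
    by (simp add: cinner_scaleC_left a_def sgn_eq complex_norm_square[symmetric]
        power2_eq_square field_simps)
  then have "cmod (cinner x y) = Re (cinner (a *\<^sub>C x) y)"
    by simp
  also have "\<dots> \<le> norm x * norm y"
    using Re_cinner_le[of "a *\<^sub>C x" y] by (simp add: norm_scaleC a)
  finally show ?thesis .
qed simp

lemma cinner_ext:
  fixes u v :: "'a::complex_inner"
  assumes "\<And>w. cinner w u = cinner w v"
  shows "u = v"
proof -
  have "cinner (u - v) (u - v) = 0"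
    using assms by (simp add: cinner_diff_right)
  then show ?thesis
    by (simp add: cinner_self)
qed

lemma bounded_linear_cinner_left: "bounded_linear (\<lambda>x. cinner x y)"
  for y :: "'a::complex_inner"
  by (rule bounded_linear_intro[where K = "norm y"])
    (auto simp: cinner_add_left cinner_scaleR_left scaleR_conv_of_real norm_cinner_le)

section \<open>Riesz representation and adjoints\<close>

lemma bounded_clinear_bounded_linear:
  assumes "bounded_clinear T"
  shows "bounded_linear T"
proof -
  obtain M where lin: "clinear T" and M: "\<And>x. norm (T x) \<le> M * norm x"
    using assms unfolding bounded_clinear_def by blast
  interpret T: Vector_Spaces.linear scaleC scaleC T
    by (rule lin)
  show ?thesis
    by (rule bounded_linear_intro[where K = M])
      (auto simp: T.add T.scale scaleR_scaleC M mult.commute)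
qed

text \<open>The representing vector is the minimiser of \<open>v \<mapsto> \<parallel>v\<parallel>\<^sup>2 - 2 Re (f v)\<close>.\<close>

theorem riesz_representation:
  fixes f :: "'a::chilbert_space \<Rightarrow> complex"
  assumes "bounded_clinear f"
  obtains u where "\<And>v. f v = cinner v u"
proof -
  interpret bounded_linear f
    by (rule bounded_clinear_bounded_linear[OF assms])
  have f_scaleC: "f (a *\<^sub>C v) = a * f v" for a v
  proof -
    interpret f: Vector_Spaces.linear scaleC scaleC f
      using assms by (simp add: bounded_clinear_def)
    show ?thesis
      by (simp add: f.scale scaleC_complex_def)
  qed
  obtain M where M: "\<And>v. cmod (f v) \<le> norm v * M"
    using bounded by blast
  define F where "F v = (norm v)\<^sup>2 - 2 * Re (f v)" for v
  have F_ge: "- (M\<^sup>2) \<le> F v" for v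
  proof -
    have "Re (f v) \<le> norm v * M"
      using M[of v] complex_Re_le_cmod[of "f v"] by linarith
    moreover have "0 \<le> (norm v - M)\<^sup>2"
      by simp
    ultimately show ?thesis
      unfolding F_def by (simp add: power2_diff)
  qed
  then have bdd: "bdd_below (range F)"
    by (rule bdd_belowI2)
  define m where "m = (INF v. F v)"
  have m_le: "m \<le> F v" for v
    unfolding m_def by (rule cINF_lower[OF bdd]) simp
  have "\<exists>v. F v < m + inverse (real (Suc n))" for n
    using cINF_less_iff[of UNIV F "m + inverse (real (Suc n))"] bdd
    by (auto simp: m_def)
  then obtain v where v: "\<And>n. F (v n) < m + inverse (real (Suc n))"
    by metis
  \<comment> \<open>The parallelogram law: the terms in \<open>f\<close> cancel by linearity, so two
    points where \<open>F\<close> is nearly minimal must be close.\<close>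
  have par: "(norm (a - b))\<^sup>2 = 2 * F a + 2 * F b - 4 * F ((1/2) *\<^sub>R (a + b))" for a b
    by (simp add: F_def norm_diff_sq norm_add_sq add scaleR power_mult_distrib
        cinner_scaleR_left cinner_scaleR_right power_divide field_simps)
  have "Cauchy v"
  proof (rule metric_CauchyI)
    fix e :: real
    assume "0 < e"
    \<comment> \<open>With both values of \<open>F\<close> below \<open>m + e\<^sup>2 / 4\<close>
      and the midpoint value at least \<open>m\<close>, \<open>par\<close> gives exactly the bound
      \<open>e\<^sup>2\<close>.\<close>
    then obtain N where N: "inverse (real (Suc N)) < e\<^sup>2 / 4"
      using reals_Archimedean[of "e\<^sup>2 / 4"] by auto
    have "dist (v i) (v j) < e" if "N \<le> i" "N \<le> j" for i j
    proof -
      have "inverse (real (Suc i)) \<le> inverse (real (Suc N))"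
        "inverse (real (Suc j)) \<le> inverse (real (Suc N))"
        using that by (simp_all add: le_imp_inverse_le)
      then have "(norm (v i - v j))\<^sup>2 < e\<^sup>2"
        using par[of "v i" "v j"] v[of i] v[of j] m_le[of "(1/2) *\<^sub>R (v i + v j)"] N
        by linarith
      then show ?thesis
        using \<open>0 < e\<close> by (simp add: dist_norm power_less_imp_less_base)
    qed
    then show "\<exists>N. \<forall>i\<ge>N. \<forall>j\<ge>N. dist (v i) (v j) < e"
      by blast
  qed
  then obtain u where u: "v \<longlonglongrightarrow> u"
    using Cauchy_convergent convergent_def by blast
  have "(\<lambda>n. F (v n)) \<longlonglongrightarrow> F u"
    unfolding F_def by (intro tendsto_intros tendsto u)
  moreover have "(\<lambda>n. m + inverse (real (Suc n))) \<longlonglongrightarrow> m"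
    using LIMSEQ_inverse_real_of_nat_add by simp
  ultimately have "F u \<le> m"
    by (rule LIMSEQ_le) (use v less_imp_le in blast)
  then have min: "F u \<le> F w" for w
    using m_le[of w] by linarith
  have Re_eq: "Re (f w) = Re (cinner w u)" for w
  proof (rule ccontr)
    define d where "d = Re (f w) - Re (cinner w u)"
    assume "Re (f w) \<noteq> Re (cinner w u)"
    then have d: "d \<noteq> 0"
      by (simp add: d_def)
    have expand: "F (u + t *\<^sub>R w) = F u + t\<^sup>2 * (norm w)\<^sup>2 - 2 * t * d" for t
      by (simp add: F_def norm_add_sq add scaleR d_def cinner_scaleR_right
          Re_cinner_commute[of u w] power_mult_distrib algebra_simps)
    \<comment> \<open>A step along \<open>w\<close> that would push \<open>F\<close> below its
      minimum: the increment equals \<open>- t\<^sup>2 * ((norm w)\<^sup>2 + 2)\<close>. The added 1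
      keeps the denominator positive.\<close>
    define t where "t = d / ((norm w)\<^sup>2 + 1)"
    have pos: "0 < (norm w)\<^sup>2 + 1"
      by (simp add: add_nonneg_pos)
    have "t\<^sup>2 * (norm w)\<^sup>2 - 2 * t * d \<ge> 0"
      using min[of "u + t *\<^sub>R w"] by (simp add: expand)
    moreover have "t * d = t\<^sup>2 * ((norm w)\<^sup>2 + 1)"
      using pos by (simp add: t_def power2_eq_square)
    moreover have "0 < t\<^sup>2"
      using d pos by (simp add: t_def)
    moreover have "0 \<le> t\<^sup>2 * (norm w)\<^sup>2"
      by simp
    ultimately show False
      by (simp add: algebra_simps)
  qed
  \<comment> \<open>The real part at \<open>(- \<i>) *\<^sub>C w\<close> is the imaginary part at
    \<open>w\<close>.\<close>
  have "f w = cinner w u" for w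
    using Re_eq[of w] Re_eq[of "(- \<i>) *\<^sub>C w"]
    by (simp add: f_scaleC cinner_scaleC_left complex_eq_iff)
  then show ?thesis
    using that by blast
qed

text \<open>Riesz applied to each functional \<open>\<lambda>x. cinner (T x) z\<close> yields an
  adjoint, and nondegeneracy makes it unique, so the description in \<open>cadjoint\<close> denotes
  it.\<close>

lemma cinner_cadjoint:
  fixes T :: "'a::chilbert_space \<Rightarrow> 'b::complex_inner"
  assumes "bounded_clinear T"
  shows "cinner (T x) y = cinner x (cadjoint T y)"
proof -
  obtain M where lin: "clinear T" and M: "\<And>x. norm (T x) \<le> M * norm x"
    using assms unfolding bounded_clinear_def by blast
  interpret T: Vector_Spaces.linear scaleC scaleC T
    by (rule lin)
  have functional: "bounded_clinear (\<lambda>x. cinner (T x) z)" for z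
    unfolding bounded_clinear_def
  proof
    show "clinear (\<lambda>x. cinner (T x) z)"
      unfolding linear_iff_module_hom module_hom_iff module_iff_vector_space
      by (simp add: vector_space_scaleC T.add T.scale cinner_add_left cinner_scaleC_left
          scaleC_complex_def)
    have "cmod (cinner (T x) z) \<le> (M * norm z) * norm x" for x
    proof -
      have "cmod (cinner (T x) z) \<le> norm (T x) * norm z"
        by (rule norm_cinner_le)
      also have "\<dots> \<le> (M * norm x) * norm z"
        by (intro mult_right_mono M) simp
      finally show ?thesis
        by (simp add: mult_ac)
    qed
    then show "\<exists>M. \<forall>x. cmod (cinner (T x) z) \<le> M * norm x"
      by blast
  qed
  have "\<forall>z. \<exists>u. \<forall>x. cinner (T x) z = cinner x u"
  proof
    fix z
    show "\<exists>u. \<forall>x. cinner (T x) z = cinner x u"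
      by (rule riesz_representation[OF functional[of z]]) (rule exI, rule allI)
  qed
  from choice[OF this] obtain S where S: "\<forall>z x. cinner (T x) z = cinner x (S z)"
    by (rule exE)
  have "cadjoint T = S"
    unfolding cadjoint_def
  proof (rule the_equality)
    show "\<forall>x y. cinner (T x) y = cinner x (S y)"
      by (intro allI) (rule S[rule_format])
    fix S'
    assume S': "\<forall>x y. cinner (T x) y = cinner x (S' y)"
    show "S' = S"
    proof
      fix y
      show "S' y = S y"
        by (rule cinner_ext) (simp only: S[rule_format, symmetric] S'[rule_format, symmetric])
    qed
  qed
  then show ?thesis
    by (simp only: S[rule_format])
qed

section \<open>Douglas majorisation by Baire category\<close>

text \<open>
  One implication of Douglas' majorisation theorem. It is the uniform boundedness principle
  for the functionals \<open>w \<mapsto> \<langle>Q w, z\<rangle>\<close> divided by \<open>\<parallel>K\<^sup>* z\<parallel>\<close>: at \<open>w\<close> with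
  \<open>Q w = K v\<close> they are bounded by \<open>\<parallel>v\<parallel>\<close>.
\<close>

theorem range_inclusion_imp_cadjoint_bound:
  fixes K :: "'a::chilbert_space \<Rightarrow> 'c::complex_inner"
    and Q :: "'b::chilbert_space \<Rightarrow> 'c"
  assumes K: "bounded_clinear K" and Q: "bounded_clinear Q" and sub: "range Q \<subseteq> range K"
  obtains c where "1 \<le> c" "\<And>z. norm (cadjoint Q z) \<le> c * norm (cadjoint K z)"
proof -
  interpret Q: bounded_linear Q
    by (rule bounded_clinear_bounded_linear[OF Q])
  define C where "C n = {w. \<forall>z. cmod (cinner (Q w) z) \<le> real n * norm (cadjoint K z)}" for n
  have closed: "closed (C n)" for n
    unfolding C_def
    by (intro closed_Collect_all closed_Collect_le continuous_intros
        bounded_linear.continuous_on[OF bounded_linear_cinner_left]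
        Q.continuous_on)
  have cover: "(\<Union>n. C n) = UNIV"
  proof -
    have "\<exists>n. w \<in> C n" for w
    proof -
      obtain v where v: "Q w = K v"
        using sub by blast
      obtain n where n: "norm v \<le> real n"
        using real_arch_simple by blast
      have "cmod (cinner (Q w) z) \<le> real n * norm (cadjoint K z)" for z
      proof -
        have "cmod (cinner (Q w) z) \<le> norm v * norm (cadjoint K z)"
          by (simp add: v cinner_cadjoint[OF K] norm_cinner_le)
        also have "\<dots> \<le> real n * norm (cadjoint K z)"
          by (intro mult_right_mono n) simp
        finally show ?thesis .
      qed
      then show ?thesis
        by (auto simp: C_def)
    qed
    then show ?thesis
      by blast
  qed
  have "\<exists>n. interior (C n) \<noteq> {}"
  proof (rule ccontr)
    assume "\<nexists>n. interior (C n) \<noteq> {}"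
    \<comment> \<open>Baire: in a complete space, countably many closed sets with empty interior
      cannot cover.\<close>
    then have "euclidean interior_of (\<Union>(range C)) = {}"
      using closed by (intro Baire_category_alt) (auto simp: completely_metrizable_space_euclidean)
    then show False
      by (simp add: cover)
  qed
  then obtain n where "interior (C n) \<noteq> {}"
    by blast
  then obtain w0 r where r: "0 < r" and ball: "cball w0 r \<subseteq> C n"
    by (meson ex_in_conv mem_interior_cball)
  \<comment> \<open>Writing \<open>w\<close> as the difference of \<open>w0 + w\<close> and
    \<open>w0\<close>, both in the ball, moves the bound to the origin at the cost of a factor
    2.\<close>
  have small: "cmod (cinner (Q w) z) \<le> 2 * real n * norm (cadjoint K z)" if "norm w \<le> r" for w z
  proof -
    have "w0 \<in> C n" "w0 + w \<in> C n"
      using that r by (auto intro!: subsetD[OF ball] simp: dist_norm)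
    then have "cmod (cinner (Q w0) z) \<le> real n * norm (cadjoint K z)"
      "cmod (cinner (Q w0) z + cinner (Q w) z) \<le> real n * norm (cadjoint K z)"
      by (auto simp: C_def Q.add cinner_add_left)
    then show ?thesis
      using norm_triangle_ineq4[of "cinner (Q w0) z + cinner (Q w) z" "cinner (Q w0) z"]
      by simp
  qed
  \<comment> \<open>The maximum with 1 ensures that dividing by \<open>c\<^sup>2\<close> later only
    shrinks the lower frame constant.\<close>
  define c where "c = max 1 (2 * real n / r)"
  have "norm (cadjoint Q z) \<le> c * norm (cadjoint K z)" for z
  proof (cases "cadjoint Q z = 0")
    case False
    define q where "q = cadjoint Q z"
    have q: "0 < norm q"
      using False by (simp add: q_def)
    \<comment> \<open>The test vector is \<open>cadjoint Q z\<close> rescaled to norm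
      \<open>r\<close>, where Cauchy-Schwarz is attained.\<close>
    have "cinner (Q ((r / norm q) *\<^sub>R q)) z = complex_of_real (r * norm q)"
      using q by (simp add: Q.scaleR scaleR_scaleC cinner_scaleC_left cinner_cadjoint[OF Q]
          q_def[symmetric] cinner_self power2_eq_square)
    then have "r * norm q \<le> 2 * real n * norm (cadjoint K z)"
      using small[of "(r / norm q) *\<^sub>R q" z] r q by (simp add: norm_mult)
    then have "norm q \<le> (2 * real n / r) * norm (cadjoint K z)"
      using r by (simp add: field_simps)
    also have "\<dots> \<le> c * norm (cadjoint K z)"
      unfolding c_def by (intro mult_right_mono) auto
    finally show ?thesis
      by (simp add: q_def)
  qed (simp add: c_def)
  then show ?thesis
    using that[of c] by (simp add: c_def)
qed

section \<open>Transfer of the frame bounds\<close>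

theorem proposition2p4:
  fixes \<beta> :: "'h::chilbert_space \<Rightarrow> 'b::cbanach \<Rightarrow> 'z::chilbert_space"
    and K Q :: "'z \<Rightarrow> 'z"
    and x :: "nat \<Rightarrow> 'b"
  assumes "separable_space (euclidean :: 'h topology)"
    and "bounded_cbilinear \<beta>"
    and "closure (range (\<lambda>(h, b). \<beta> h b)) = UNIV"
    and "bounded_clinear K"
    and "K_flat_frame \<beta> K x"
    and "bounded_clinear Q"
    and "range Q \<subseteq> range K"
  shows "K_flat_frame \<beta> Q x"
proof -
  obtain c where c: "1 \<le> c"
    and le: "\<And>z. norm (cadjoint Q z) \<le> c * norm (cadjoint K z)"
    using range_inclusion_imp_cadjoint_bound[OF assms(4,6,7)] by blast
  obtain A B where AB: "0 < A" "A \<le> B"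
    and frame: "\<And>z. summable (\<lambda>i. (norm (flat_dual \<beta> z (x i)))\<^sup>2)"
      "\<And>z. A * (norm (cadjoint K z))\<^sup>2 \<le> (\<Sum>i. (norm (flat_dual \<beta> z (x i)))\<^sup>2)"
      "\<And>z. (\<Sum>i. (norm (flat_dual \<beta> z (x i)))\<^sup>2) \<le> B * (norm z)\<^sup>2"
    using assms(5) unfolding K_flat_frame_def by blast
  have "A / c\<^sup>2 * (norm (cadjoint Q z))\<^sup>2 \<le> (\<Sum>i. (norm (flat_dual \<beta> z (x i)))\<^sup>2)" for z
  proof -
    have "A / c\<^sup>2 * (norm (cadjoint Q z))\<^sup>2 \<le> A / c\<^sup>2 * (c * norm (cadjoint K z))\<^sup>2"
      using AB le[of z] by (intro mult_left_mono power_mono) auto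
    also have "\<dots> = A * (norm (cadjoint K z))\<^sup>2"
      using c by (simp add: power_mult_distrib)
    finally show ?thesis
      using frame(2)[of z] by linarith
  qed
  moreover have "0 < A / c\<^sup>2"
    using AB c by simp
  \<comment> \<open>The definition demands ordered constants; \<open>1 \<le> c\<close> gives this
    with the old \<open>B\<close>.\<close>
  moreover have "A / c\<^sup>2 \<le> B"
  proof -
    have "A / c\<^sup>2 \<le> A"
      using AB c by (simp add: divide_le_eq one_le_power)
    then show ?thesis
      using AB by linarith
  qed
  ultimately show ?thesis
    unfolding K_flat_frame_def using frame(1,3) by blast
qed

end
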